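(* The set of ordered pairs $(a,b)$ of positive integers with $a\le b$ for which $a^2b^2-4(a+b)^2$ is a square is given by the disjoint union $\mathcal{T}_3\cup\mathcal{T}_4\cup\mathcal{T}_5$, where \begin{align*} \mathcal{T}_3&=\{(3q,3r)\in\mathbb{N}^2 \mid \exists (m,n)\in\mathbb{N}^2,\ m^2+n^2+q^2=3mnq \ \text{ and }\ q\le r=3mn-q\},\\ \mathcal{T}_4&=\{(4q,4r)\in\mathbb{N}^2 \mid \exists (m,n)\in\mathbb{N}^2,\ m^2+n^2+2q^2=4mnq \ \text{ and }\ q\le r=2mn-q\},\\ \mathcal{T}_5&=\{(5q,5r)\in\mathbb{N}^2 \mid \exists (m,n)\in\mathbb{N}^2,\ m^2+n^2+5q^2=5mnq \ \text{ and }\ q\le r=mn-q\}, \end{align*} with $q,r\in\mathbb{N}$. Furthermore, for each $i=3,4,5$, if $(a,b)\in\mathcal{T}_i$, then $\gcd(a,b)=i$.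
   Context: $\mathbb{N}=\{n\in\mathbb{Z}\mid n>0\}$. "Square" means the square of an integer (so $0$ is a square). *)

theory Defs
  imports Complex_Main
begin

definition T3 :: "(int \<times> int) set" where
  "T3 = {(3 * q, 3 * r) | q r. q > 0 \<and> r > 0 \<and>
     (\<exists>m n. m > 0 \<and> n > 0 \<and> m^2 + n^2 + q^2 = 3 * m * n * q \<and> q \<le> r \<and> r = 3 * m * n - q)}"

definition T4 :: "(int \<times> int) set" where
  "T4 = {(4 * q, 4 * r) | q r. q > 0 \<and> r > 0 \<and>
     (\<exists>m n. m > 0 \<and> n > 0 \<and> m^2 + n^2 + 2 * q^2 = 4 * m * n * q \<and> q \<le> r \<and> r = 2 * m * n - q)}"

definition T5 :: "(int \<times> int) set" where
  "T5 = {(5 * q, 5 * r) | q r. q > 0 \<and> r > 0 \<and>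
     (\<exists>m n. m > 0 \<and> n > 0 \<and> m^2 + n^2 + 5 * q^2 = 5 * m * n * q \<and> q \<le> r \<and> r = m * n - q)}"

end

theory Submission
  imports Defs "HOL-Number_Theory.Cong"
begin

text \<open>
  Write \<open>a = g q\<close>, \<open>b = g r\<close> with \<open>q\<close>, \<open>r\<close> coprime. The condition says that
  \<open>(g q r - 2 (q + r)) (g q r + 2 (q + r))\<close> is a square, so the two factors are \<open>l u\<^sup>2\<close> and
  \<open>l v\<^sup>2\<close>; up to a factor, \<open>m = v + u\<close> and \<open>n = v - u\<close> satisfy \<open>q + r = k m n\<close>,
  \<open>h q r = m\<^sup>2 + n\<^sup>2\<close> with \<open>g = k h\<close>. Eliminating \<open>r\<close> gives the Markov-type equation
  \<open>m\<^sup>2 + n\<^sup>2 + h q\<^sup>2 = k h m n q\<close>, and Vieta descent leaves only five pairs \<open>(k, h)\<close>. Two of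
  them force \<open>q\<close> and \<open>r\<close> to have a common factor; the other three give the three families.
  Conversely, a common prime factor \<open>p\<close> of \<open>q\<close> and \<open>r\<close> would divide \<open>m\<close> and \<open>n\<close>, and
  cancelling it would give a solution for the impossible pair \<open>(p k, h)\<close>.
\<close>

section \<open>Square products, and size bounds for reduced solutions\<close>

text \<open>Dividing \<open>s\<close> and \<open>B\<close> by \<open>d = gcd s B\<close> leaves
  \<open>A * v = d * u^2\<close> with \<open>u\<close>, \<open>v\<close> coprime. So
  \<open>v\<close> divides \<open>d\<close>, and the common factor is
  \<open>l = d / v\<close>.\<close>

lemma square_productE:
  fixes A B s :: int
  assumes "A * B = s^2" "0 \<le> A" "0 < B"
  obtains l u v where "0 < l" "0 \<le> u" "0 < v" "A = l * u^2" "B = l * v^2"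
proof -
  define d where "d = gcd s B"
  have d: "d > 0" using assms unfolding d_def by simp
  obtain u v where uv: "s = d * u" "B = d * v" "coprime u v"
    using gcd_coprime_exists[of s B] assms unfolding d_def by (metis gcd_eq_0_iff less_irrefl mult.commute)
  have v: "v > 0" using uv(2) d assms(3) by (simp add: zero_less_mult_iff)
  have "d * (A * v) = d * (d * u^2)" using assms(1) uv by (simp add: power2_eq_square algebra_simps)
  then have e: "A * v = d * u^2" using d by simp
  then have "v dvd d * u^2" by (metis dvd_triv_right)
  then have "v dvd d" using uv(3)
    by (metis coprime_commute coprime_dvd_mult_left_iff coprime_power_right_iff)
  then obtain l where l: "d = v * l" by auto
  have "v * A = v * (l * u^2)" using e l by (simp add: algebra_simps)
  then have "A = l * \<bar>u\<bar>^2" using v by simp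
  moreover have "B = l * v^2" using uv l by (simp add: power2_eq_square)
  moreover have "l > 0" using l d v by (simp add: zero_less_mult_iff)
  ultimately show thesis using that[of l "\<bar>u\<bar>" v] v by simp
qed

text \<open>Meant for the two Vieta roots \<open>t\<close>, \<open>t'\<close> in the largest
  variable and the square \<open>y\<close> of the middle one: \<open>t * t'\<close> is then the sum
  of the two smaller squares, hence between \<open>y\<close> and \<open>2 * y\<close>. The lower
  bound is AM-GM. For the upper one, \<open>t * t' \<le> 2 * t^2\<close> gives
  \<open>t' \<le> 2 * t\<close>, so \<open>(2 * t' - t) * (2 * t - t')\<close> is
  nonnegative.\<close>

lemma square_sum_bounds:
  fixes t t' y :: int
  assumes "0 < t" "t \<le> t'" "y \<le> t^2" "y < t * t'" "t * t' \<le> 2 * y"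
  shows "4 * y < (t + t')^2" "(t + t')^2 \<le> 9 * y"
proof -
  have "(t + t')^2 - 4 * (t * t') = (t - t')^2" by (simp add: power2_eq_square algebra_simps)
  then show "4 * y < (t + t')^2" using assms(4) zero_le_power2[of "t - t'"] by linarith
  have "t * t' \<le> t * (2 * t)" using assms unfolding power2_eq_square by linarith
  then have "t' \<le> 2 * t" using assms(1) by (simp only: mult_le_cancel_left_pos)
  then have "0 \<le> (2 * t' - t) * (2 * t - t')" using assms by simp
  also have "\<dots> = 9 * (t * t') - 2 * (t + t')^2" by (simp add: power2_eq_square algebra_simps)
  finally show "(t + t')^2 \<le> 9 * y" using assms(5) by linarith
qed

text \<open>
  With \<open>z = \<surd>h q\<close> and \<open>c = k \<surd>h\<close> the equation is \<open>m\<^sup>2 + n\<^sup>2 + z\<^sup>2 = c m n z\<close>. At a Vieta-reduced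
  solution the smallest variable \<open>x\<close> satisfies \<open>2 < c x \<le> 3\<close>; the conclusion is this bound,
  squared, for \<open>x = n\<close> or \<open>x = z\<close>.
\<close>

lemma reduced_small:
  fixes m n q k h :: int
  assumes pos: "0 < m" "0 < n" "0 < q" "0 < k" "0 < h"
    and eq: "m^2 + n^2 + h * q^2 = k * h * m * n * q"
    and nm: "n \<le> m" and red: "2 * m \<le> k * h * n * q" "2 * q \<le> k * m * n"
  shows "(4 < k^2 * h * n^2 \<and> k^2 * h * n^2 \<le> 9) \<or> (4 < (k * h * q)^2 \<and> (k * h * q)^2 \<le> 9)"
proof -
  have n2: "0 < n^2" "0 < m^2" "0 < h * q^2" using pos by auto
  have nm2: "n^2 \<le> m^2" using nm pos by simp
  show ?thesis
  proof (cases "m^2 \<le> h * q^2")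
    case True
    define q' where "q' = k * m * n - q"
    have prod: "h * (q * q') = m^2 + n^2" using eq unfolding q'_def
      by (simp add: power2_eq_square algebra_simps)
    have h: "h > 0" using pos by simp
    \<comment> \<open>The largest variable is \<open>z\<close> here. Its two roots are multiplied by
      the square root of \<open>h\<close>, and \<open>y = m^2\<close> by \<open>h\<close>, to keep
      all quantities integral.\<close>
    have e: "h * q * (h * q') = h * (m^2 + n^2)" unfolding prod[symmetric] by simp
    have c1: "0 < h * q" using pos by simp
    have c2: "h * q \<le> h * q'" using red pos unfolding q'_def by simp
    have "h * m^2 \<le> h * (h * q^2)" using True h by simp
    then have c3: "h * m^2 \<le> (h * q)^2" by (simp add: power2_eq_square algebra_simps)
    have c4: "h * m^2 < h * q * (h * q')" unfolding e using n2 h by simp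
    have c5: "h * q * (h * q') \<le> 2 * (h * m^2)" unfolding e using nm2 h by (simp add: algebra_simps)
    note a = square_sum_bounds[OF c1 c2 c3 c4 c5]
    have "(h * q + h * q')^2 = (h * m^2) * (k^2 * h * n^2)" unfolding q'_def
      by (simp add: power2_eq_square algebra_simps)
    moreover have "0 < h * m^2" using n2 h by simp
    ultimately have "4 < k^2 * h * n^2" "k^2 * h * n^2 \<le> 9"
      using a by (simp_all only: mult_less_cancel_left_pos mult_le_cancel_left_pos
        mult.commute[of _ "h * m^2"])
    then show ?thesis by blast
  next
    case False
    define m' where "m' = k * h * n * q - m"
    have prod: "m * m' = n^2 + h * q^2" using eq unfolding m'_def
      by (simp add: power2_eq_square algebra_simps)
    have le: "m \<le> m'" using red unfolding m'_def by simp
    show ?thesis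
    \<comment> \<open>Now \<open>m\<close> is the largest variable; the split decides whether
      \<open>z\<close> or \<open>n\<close> is the middle one.\<close>
    proof (cases "n^2 \<le> h * q^2")
      case True
      have "4 * (h * q^2) < (m + m')^2" "(m + m')^2 \<le> 9 * (h * q^2)"
        using square_sum_bounds[of m m' "h * q^2"] pos le False n2 True prod by auto
      moreover have "(m + m')^2 = (h * q^2) * (k^2 * h * n^2)" unfolding m'_def
        by (simp add: power2_eq_square algebra_simps)
      ultimately have "4 < k^2 * h * n^2" "k^2 * h * n^2 \<le> 9"
        using n2(3) by (simp_all only: mult_less_cancel_left_pos mult_le_cancel_left_pos
          mult.commute[of _ "h * q^2"])
      then show ?thesis by blast
    next
      case False
      have "4 * n^2 < (m + m')^2" "(m + m')^2 \<le> 9 * n^2"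
        using square_sum_bounds[of m m' "n^2"] pos le False n2 nm2 prod by auto
      moreover have "(m + m')^2 = n^2 * (k * h * q)^2" unfolding m'_def
        by (simp add: power2_eq_square algebra_simps)
      ultimately show ?thesis using n2 by (simp add: mult.commute[of _ "n^2"])
    qed
  qed
qed

section \<open>Sums of squares modulo 3, 4 and 7\<close>

lemma three_dvd_sum_squares:
  fixes m n :: int
  assumes "3 dvd m^2 + n^2"
  shows "3 dvd m \<and> 3 dvd n"
proof -
  have "[(m mod 3)^2 + (n mod 3)^2 = m^2 + n^2] (mod 3)"
    by (intro cong_add cong_pow) auto
  then have "((m mod 3)^2 + (n mod 3)^2) mod 3 = 0" using assms by (simp add: cong_def)
  moreover have "m mod 3 = 0 \<or> m mod 3 = 1 \<or> m mod 3 = 2" "n mod 3 = 0 \<or> n mod 3 = 1 \<or> n mod 3 = 2"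
    by presburger+
  ultimately show ?thesis unfolding dvd_eq_mod_eq_0 by - (elim disjE; simp only:; simp)
qed

lemma four_dvd_sum_squares:
  fixes m n :: int
  assumes "4 dvd m^2 + n^2"
  shows "2 dvd m \<and> 2 dvd n"
proof -
  have "[(m mod 4)^2 + (n mod 4)^2 = m^2 + n^2] (mod 4)"
    by (intro cong_add cong_pow) auto
  then have "((m mod 4)^2 + (n mod 4)^2) mod 4 = 0" using assms by (simp add: cong_def)
  moreover have "m mod 4 = 0 \<or> m mod 4 = 1 \<or> m mod 4 = 2 \<or> m mod 4 = 3"
    "n mod 4 = 0 \<or> n mod 4 = 1 \<or> n mod 4 = 2 \<or> n mod 4 = 3" by presburger+
  ultimately have "m mod 4 mod 2 = 0 \<and> n mod 4 mod 2 = 0" by - (elim disjE; simp only:; simp)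
  then show ?thesis by presburger
qed

lemma seven_not_dvd_square_plus_one:
  fixes m :: int
  shows "\<not> 7 dvd m^2 + 1"
proof
  assume "7 dvd m^2 + 1"
  moreover have "[(m mod 7)^2 + 1 = m^2 + 1] (mod 7)" by (intro cong_add cong_pow) auto
  ultimately have "((m mod 7)^2 + 1) mod 7 = 0" by (simp add: cong_def)
  moreover have "m mod 7 = 0 \<or> m mod 7 = 1 \<or> m mod 7 = 2 \<or> m mod 7 = 3
    \<or> m mod 7 = 4 \<or> m mod 7 = 5 \<or> m mod 7 = 6" by presburger
  ultimately show False by auto
qed

section \<open>Vieta descent and the five pairs\<close>

text \<open>All five pairs occur: a solution for \<open>(p * k, h)\<close> multiplied by
  \<open>p\<close> solves \<open>(k, h)\<close>, so \<open>(1, 1)\<close> and \<open>(1, 2)\<close>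
  arise from \<open>(3, 1)\<close> and \<open>(2, 2)\<close>.\<close>

definition solvable_pairs :: "(int \<times> int) set" where
  "solvable_pairs = {(3, 1), (2, 2), (1, 5), (1, 1), (1, 2)}"

lemma reduced_solvable:
  fixes m n q k h :: int
  assumes pos: "0 < m" "0 < n" "0 < q" "0 < k" "0 < h"
    and eq: "m^2 + n^2 + h * q^2 = k * h * m * n * q"
    and nm: "n \<le> m" and red: "2 * m \<le> k * h * n * q" "2 * q \<le> k * m * n"
  shows "(k, h) \<in> solvable_pairs"
  using reduced_small[OF assms]
proof
  assume A: "4 < k^2 * h * n^2 \<and> k^2 * h * n^2 \<le> 9"
  have p: "1 \<le> k^2" "1 \<le> n^2" "1 \<le> h"
    using pos by (simp_all add: int_one_le_iff_zero_less)
  have "k^2 \<le> k^2 * (h * n^2)" "h \<le> h * (k^2 * n^2)" "n^2 \<le> n^2 * (k^2 * h)"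
    using p pos by (simp_all add: int_one_le_iff_zero_less)
  moreover have "k^2 * (h * n^2) \<le> 9" "h * (k^2 * n^2) \<le> 9" "n^2 * (k^2 * h) \<le> 9"
    using A by (simp_all only: ac_simps)
  ultimately have b: "k^2 \<le> 9" "h \<le> 9" "n^2 \<le> 9" by (blast intro: order_trans)+
  have "k^2 \<le> 3^2" "n^2 \<le> 3^2" using b by simp_all
  then have "k \<le> 3" "n \<le> 3" using power2_le_imp_le[of k 3] power2_le_imp_le[of n 3] by simp_all
  then have "k = 1 \<or> k = 2 \<or> k = 3" "n = 1 \<or> n = 2 \<or> n = 3"
    "h = 1 \<or> h = 2 \<or> h = 3 \<or> h = 4 \<or> h = 5 \<or> h = 6 \<or> h = 7 \<or> h = 8 \<or> h = 9"
    using pos b(2) by presburger+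
  then have "(k, h) \<in> solvable_pairs \<or> k = 1 \<and> n = 1 \<and> (h = 6 \<or> h = 7 \<or> h = 8 \<or> h = 9)"
    using A by - (elim disjE; simp add: solvable_pairs_def)
  \<comment> \<open>Here \<open>h\<close> divides \<open>m^2 + 1\<close>, but -1 is not a square
    modulo 3, 4 or 7.\<close>
  moreover have "\<not> (k = 1 \<and> n = 1 \<and> (h = 6 \<or> h = 7 \<or> h = 8 \<or> h = 9))"
  proof safe
    assume kn: "k = 1" "n = 1"
    have "m^2 + 1 = h * (m * q - q^2)" using eq kn by (simp add: algebra_simps)
    then have d: "h dvd m^2 + 1" by simp
    have "3 dvd h \<Longrightarrow> False" using three_dvd_sum_squares[of m 1] dvd_trans[OF _ d] by auto
    moreover have "4 dvd h \<Longrightarrow> False" using four_dvd_sum_squares[of m 1] dvd_trans[OF _ d] by auto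
    moreover have "7 dvd h \<Longrightarrow> False" using seven_not_dvd_square_plus_one[of m] dvd_trans[OF _ d] by auto
    ultimately show "h = 6 \<Longrightarrow> False" "h = 7 \<Longrightarrow> False" "h = 8 \<Longrightarrow> False" "h = 9 \<Longrightarrow> False" by auto
  qed
  ultimately show ?thesis by blast
next
  assume B: "4 < (k * h * q)^2 \<and> (k * h * q)^2 \<le> 9"
  have "0 < k * h * q" using pos by simp
  moreover have "(k * h * q)^2 \<le> 3^2" "2^2 < (k * h * q)^2" using B by auto
  ultimately have "k * h * q \<le> 3" "2 < k * h * q"
    using power2_le_imp_le[of "k * h * q" 3] power2_less_imp_less[of 2 "k * h * q"] by simp_all
  then have khq: "k * h * q = 3" by simp
  have "k \<le> k * (h * q)" "h \<le> h * (k * q)" "q \<le> q * (k * h)"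
    using pos by (simp_all add: int_one_le_iff_zero_less)
  moreover have "k * (h * q) = 3" "h * (k * q) = 3" "q * (k * h) = 3"
    using khq by (simp_all only: ac_simps)
  ultimately have "k \<le> 3" "h \<le> 3" "q \<le> 3" by metis+
  then have "k = 1 \<or> k = 2 \<or> k = 3" "q = 1 \<or> q = 2 \<or> q = 3" "h = 1 \<or> h = 2 \<or> h = 3"
    using pos by presburger+
  then have "(k, h) \<in> solvable_pairs \<or> k = 1 \<and> q = 1 \<and> h = 3"
    using khq by - (elim disjE; simp add: solvable_pairs_def)
  moreover have "\<not> (k = 1 \<and> q = 1 \<and> h = 3)"
  proof
    assume "k = 1 \<and> q = 1 \<and> h = 3"
    then have e: "m^2 + n^2 = 3 * (m * n - 1)" using eq by (simp add: algebra_simps)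
    then have "3 dvd m^2 + n^2" by simp
    then obtain x y where "m = 3 * x" "n = 3 * y" using three_dvd_sum_squares by (meson dvdE)
    \<comment> \<open>Dividing by 3 once leaves -1 divisible by 3.\<close>
    with e have "3 * (x^2 + y^2) = 9 * (x * y) - 1" by (simp add: power2_eq_square algebra_simps)
    moreover have "3 * A = 9 * B - 1 \<Longrightarrow> False" for A B :: int by presburger
    ultimately show False by blast
  qed
  ultimately show ?thesis by blast
qed

lemma markov_solvable:
  fixes m n q k h :: int
  assumes "0 < m" "0 < n" "0 < q" "0 < k" "0 < h"
    and "m^2 + n^2 + h * q^2 = k * h * m * n * q"
  shows "(k, h) \<in> solvable_pairs"
  using assms
proof (induction "nat (m + n + q)" arbitrary: m n q rule: less_induct)
  case less
  note pos = less.prems(1-5)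
  \<comment> \<open>The pair \<open>m'\<close>, \<open>n'\<close> is \<open>m\<close>,
    \<open>n\<close> in decreasing order, so only the larger of the two ever has to be
    replaced.\<close>
  have main: "(k, h) \<in> solvable_pairs"
    if mn: "m' + n' = m + n" "n' \<le> m'" and pos': "0 < m'" "0 < n'"
      and eq: "m'^2 + n'^2 + h * q^2 = k * h * m' * n' * q" for m' n'
  proof (cases "2 * m' \<le> k * h * n' * q")
    case False
    \<comment> \<open>The other root of the quadratic in \<open>m'\<close>, positive because the
      product of the roots is.\<close>
    let ?x = "k * h * n' * q - m'"
    have "m' * ?x = n'^2 + h * q^2" using eq by algebra
    moreover have "0 < n'^2 + h * q^2" using pos' pos by (simp add: add_pos_nonneg)
    ultimately have "0 < ?x" using pos' by (metis zero_less_mult_pos)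
    moreover have "?x^2 + n'^2 + h * q^2 = k * h * ?x * n' * q"
      using eq by algebra
    moreover have "nat (?x + n' + q) < nat (m + n + q)"
      using False mn pos' pos by linarith
    ultimately show ?thesis using less.hyps[of ?x n' q] pos' pos by blast
  next
    case m': True
    show ?thesis
    proof (cases "2 * q \<le> k * m' * n'")
      case False
      \<comment> \<open>The other root of the quadratic in \<open>q\<close>; the same formula
        defines \<open>r\<close> in the three families.\<close>
      let ?x = "k * m' * n' - q"
      have "h * q * ?x = m'^2 + n'^2" using eq by algebra
      moreover have "0 < m'^2 + n'^2" "0 < h * q" using pos' pos by (simp_all add: add_pos_nonneg)
      ultimately have "0 < ?x" by (metis zero_less_mult_pos)
      moreover have "m'^2 + n'^2 + h * ?x^2 = k * h * m' * n' * ?x"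
        using eq by algebra
      moreover have "nat (m' + n' + ?x) < nat (m + n + q)"
        using False mn pos' pos by linarith
      ultimately show ?thesis using less.hyps[of m' n' ?x] pos' pos by blast
    next
      case True
      then show ?thesis using reduced_solvable[of m' n' q k h] pos' less.prems eq mn m' by blast
    qed
  qed
  show ?case
  proof (cases "n \<le> m")
    case True
    then show ?thesis using main[of m n] less.prems by blast
  next
    case False
    have eq': "n^2 + m^2 + h * q^2 = k * h * n * m * q" using less.prems(6) by algebra
    show ?thesis by (rule main[OF _ _ _ _ eq']) (use pos False in linarith)+
  qed
qed

section \<open>From solutions of the equation to coprimality and squares\<close>

text \<open>For each of the three values of \<open>h\<close>, the given \<open>k\<close> is the
  largest one paired with it in \<open>solvable_pairs\<close>, so \<open>p * k\<close> is too
  large.\<close>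

lemma no_common_prime:
  fixes m n q k h p :: int
  assumes "0 < m" "0 < n" "0 < q" "0 < k" "0 < h"
    and eq: "m^2 + n^2 + h * q^2 = k * h * m * n * q"
    and kh: "(k, h) \<in> {(3, 1), (2, 2), (1, 5)}"
    and p: "prime p" "p dvd m" "p dvd n" "p dvd q"
  shows False
proof -
  from p obtain x y z where xyz: "m = p * x" "n = p * y" "q = p * z" by (meson dvdE)
  have p2: "2 \<le> p" using p(1) by (simp add: prime_ge_2_int)
  have "p^2 * (x^2 + y^2 + h * z^2) = p^2 * (p * k * h * x * y * z)"
    using eq unfolding xyz by (simp add: power2_eq_square algebra_simps)
  then have "x^2 + y^2 + h * z^2 = p * k * h * x * y * z" using p2 by simp
  moreover have "0 < x" "0 < y" "0 < z" using assms(1-3) p2 unfolding xyz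
    by (simp_all add: zero_less_mult_iff)
  ultimately have "(p * k, h) \<in> solvable_pairs"
    using markov_solvable[of x y z "p * k" h] assms(4,5) p2 by simp
  then show False using kh p2 unfolding solvable_pairs_def by auto
qed

text \<open>A common prime \<open>p\<close> divides both \<open>m^2 + n^2 = h * q * r\<close> and
  \<open>k * m * n = q + r\<close>. If \<open>p\<close> does not divide \<open>k\<close>, it divides
  one of \<open>m\<close>, \<open>n\<close>, hence both. Otherwise \<open>p = k\<close> is 3 or 2,
  and sums of squares modulo 3 or 4 give the same.\<close>

lemma parametrized_coprime:
  fixes m n q r k h :: int
  assumes pos: "0 < m" "0 < n" "0 < q" "0 < k" "0 < h"
    and eq: "m^2 + n^2 + h * q^2 = k * h * m * n * q" and r: "r = k * m * n - q"
    and kh: "(k, h) \<in> {(3, 1), (2, 2), (1, 5)}"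
  shows "coprime q r"
proof (rule ccontr)
  assume "\<not> coprime q r"
  moreover have "gcd q r \<noteq> 0" using pos by simp
  ultimately obtain p where p: "prime p" "p dvd gcd q r"
    using prime_divisorE[of "gcd q r"] by (metis coprime_iff_gcd_eq_1 is_unit_gcd_iff)
  have pq: "p dvd q" "p dvd r" using p(2) by auto
  have sum: "m^2 + n^2 = h * (q * r)" using eq r by algebra
  have psum: "p dvd m^2 + n^2" using sum pq by simp
  have pkmn: "p dvd k * m * n" using pq r by (metis dvd_add diff_add_cancel)
  have "p dvd m \<and> p dvd n"
  proof (cases "p dvd k")
    case False
    then have "p dvd m \<or> p dvd n" using pkmn p(1) by (simp add: prime_dvd_mult_iff)
    then have "p dvd m^2 \<or> p dvd n^2" by (auto simp: power2_eq_square)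
    then have "p dvd m^2 \<and> p dvd n^2" using psum by (metis dvd_add_right_iff dvd_add_left_iff)
    then show ?thesis using p(1) prime_dvd_power by blast
  next
    case True
    have p2: "2 \<le> p" using p(1) by (simp add: prime_ge_2_int)
    have "p \<le> k" using True pos by (simp add: zdvd_imp_le)
    consider "k = 3" | "k = 2" "h = 2" | "k = 1" using kh by blast
    then consider "p = 3" | "p = 2" "h = 2"
    proof cases
      case 1
      then have "p \<noteq> 2" using True by auto
      then show thesis using that(1) 1 p2 \<open>p \<le> k\<close> by linarith
    next
      case 2
      then show thesis using that(2) p2 \<open>p \<le> k\<close> by linarith
    next
      case 3
      then show thesis using p2 \<open>p \<le> k\<close> by linarith
    qed
    then show ?thesis
    proof cases
      case 1
      then have "3 dvd m^2 + n^2" using psum by metis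
      then show ?thesis unfolding 1 by (rule three_dvd_sum_squares)
    next
      case 2
      have "2 dvd h" "2 dvd q * r" using pq 2 by simp_all
      then have "2 * 2 dvd h * (q * r)" by (rule mult_dvd_mono)
      then have "4 dvd m^2 + n^2" unfolding sum by simp
      then show ?thesis unfolding 2(1) by (rule four_dvd_sum_squares)
    qed
  qed
  then show False using no_common_prime pos eq kh p(1) pq by blast
qed

text \<open>With \<open>h * q * r = m^2 + n^2\<close> and \<open>q + r = k * m * n\<close> this is
  the identity \<open>(m^2 + n^2)^2 - 4 * m^2 * n^2 = (m^2 - n^2)^2\<close>, scaled.\<close>

lemma parametrized_square:
  fixes m n q r k h :: int
  assumes "m^2 + n^2 + h * q^2 = k * h * m * n * q" and "r = k * m * n - q"
  shows "(k * h * q)^2 * (k * h * r)^2 - 4 * (k * h * q + k * h * r)^2 = (k^2 * h * (m^2 - n^2))^2"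
proof -
  have sum: "h * (q * r) = m^2 + n^2" using assms by algebra
  have "(k * h * q)^2 * (k * h * r)^2 = k^4 * h^2 * (h * (q * r))^2" by algebra
  also have "\<dots> = k^4 * h^2 * (m^2 + n^2)^2" unfolding sum ..
  finally have 1: "(k * h * q)^2 * (k * h * r)^2 = k^4 * h^2 * (m^2 + n^2)^2" .
  have "k * h * q + k * h * r = k^2 * h * (m * n)"
    using assms(2) by algebra
  then show ?thesis unfolding 1 by algebra
qed

section \<open>From a square to a solution of the equation\<close>

lemma square_imp_family:
  fixes q r g c :: int
  assumes pos: "0 < q" "0 < r" "0 < g" and cop: "coprime q r"
    and sq: "(g * q)^2 * (g * r)^2 - 4 * (g * q + g * r)^2 = c^2"
  obtains k h m n where "0 < m" "0 < n" "g = k * h" "(k, h) \<in> {(3, 1), (2, 2), (1, 5)}"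
    "m^2 + n^2 + h * q^2 = k * h * m * n * q" "r = k * m * n - q"
proof -
  let ?X = "g * (q * r)" and ?Y = "2 * (q + r)"
  have "g^2 * (?X^2 - ?Y^2) = c^2" using sq by algebra
  then have "g dvd c" by (metis dvd_triv_left pow_divides_pow_iff zero_less_numeral)
  then obtain s where "c = g * s" by auto
  then have "g^2 * (?X^2 - ?Y^2) = g^2 * s^2" using \<open>g^2 * (?X^2 - ?Y^2) = c^2\<close>
    by (simp add: power_mult_distrib)
  then have "?X^2 - ?Y^2 = s^2" using pos by simp
  then have XY: "(?X - ?Y) * (?X + ?Y) = s^2" by algebra
  have "0 < ?X" "0 < ?Y" using pos by simp_all
  then have "0 < ?X + ?Y" by linarith
  moreover have "0 \<le> ?X - ?Y" using XY calculation by (metis mult_neg_pos not_le zero_le_power2)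
  ultimately obtain l u v where luv: "0 < l" "0 \<le> u" "0 < v" "?X - ?Y = l * u^2" "?X + ?Y = l * v^2"
    using square_productE[OF XY] by blast
  have "l * u^2 < l * v^2" using luv(4,5) \<open>0 < ?Y\<close> by linarith
  then have uv: "u < v" using luv by (simp add: power_less_imp_less_base)
  have X2: "2 * ?X = l * (v^2 + u^2)" and Y4: "4 * (q + r) = l * (v^2 - u^2)"
    using luv(4,5) by (simp_all add: algebra_simps)
  \<comment> \<open>If \<open>u\<close> and \<open>v\<close> have equal parity, \<open>v + u\<close>
    and \<open>v - u\<close> are halved and \<open>k = l\<close>. Otherwise both are odd, so 4
    divides \<open>l\<close> and \<open>k = l / 4\<close>.\<close>
  obtain k m n where kmn: "0 < k" "0 < m" "0 < n" "q + r = k * (m * n)" "?X = k * (m^2 + n^2)"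
  proof (cases "even (v + u)")
    case True
    then have "even (v - u)" by simp
    with True obtain m n where mn: "v + u = 2 * m" "v - u = 2 * n" by (meson dvdE)
    then have v: "v = m + n" "u = m - n" by simp_all
    show thesis
    proof (rule that[of l m n])
      show "0 < m" "0 < n" using mn uv luv by linarith+
      show "q + r = l * (m * n)" using Y4 unfolding v by (simp add: power2_eq_square algebra_simps)
      show "?X = l * (m^2 + n^2)" using X2 unfolding v by (simp add: power2_eq_square algebra_simps)
    qed (rule luv)
  next
    case False
    let ?m = "v + u" and ?n = "v - u"
    have Y: "4 * (q + r) = l * (?m * ?n)" using Y4 by (simp add: power2_eq_square algebra_simps)
    have "odd (?m * ?n)" using False by simp
    then have "coprime (2^2) (?m * ?n)" by (subst coprime_power_left_iff) simp
    then have "coprime 4 (?m * ?n)" by simp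
    moreover have "4 dvd l * (?m * ?n)" using Y by (metis dvd_triv_left)
    ultimately have "4 dvd l" by (simp add: coprime_dvd_mult_left_iff)
    then obtain k where k: "l = 4 * k" by auto
    show thesis
    proof (rule that[of k ?m ?n])
      show "0 < k" using luv k by simp
      show "0 < ?m" "0 < ?n" using uv luv by linarith+
      show "q + r = k * (?m * ?n)" using Y k by simp
      show "?X = k * (?m^2 + ?n^2)" using X2 unfolding k
        by (simp add: power2_eq_square algebra_simps)
    qed
  qed
  \<comment> \<open>Since \<open>k\<close> divides \<open>q + r\<close>, which is coprime to
    \<open>q\<close> and to \<open>r\<close>, the divisibility of \<open>g * q * r\<close> by
    \<open>k\<close> passes to \<open>g\<close>.\<close>
  have "coprime k q" "coprime k r"
  proof -
    have "coprime (q + r) q" "coprime (q + r) r" using cop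
      by (metis coprime_iff_gcd_eq_1 gcd_add1 gcd_add2 gcd.commute)+
    moreover have "k dvd q + r" using kmn by simp
    ultimately show "coprime k q" "coprime k r" by (meson coprime_divisors dvd_refl)+
  qed
  then have "coprime k (q * r)" by simp
  moreover have "k dvd g * (q * r)" unfolding kmn(5) by simp
  ultimately have "k dvd g" by (simp add: coprime_dvd_mult_left_iff)
  then obtain h where g: "g = k * h" by auto
  have h: "0 < h" using g pos kmn by (simp add: zero_less_mult_iff)
  have "k * (h * (q * r)) = k * (m^2 + n^2)" using kmn(5) g by simp
  then have hqr: "h * (q * r) = m^2 + n^2" using kmn(1) by simp
  have r: "r = k * m * n - q" using kmn(4) by simp
  have eq: "m^2 + n^2 + h * q^2 = k * h * m * n * q"
    unfolding hqr[symmetric] r by (simp add: power2_eq_square algebra_simps)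
  have "(k, h) \<in> solvable_pairs" using markov_solvable eq kmn h pos by blast
  \<comment> \<open>Modulo 3 the equation has only the zero solution, so 3 divides both
    \<open>q\<close> and \<open>r = m * n - q\<close>.\<close>
  moreover have "(k, h) \<noteq> (1, 1)"
  proof
    assume kh: "(k, h) = (1, 1)"
    have e: "m^2 + n^2 + q^2 = m * n * q" using eq kh by simp
    have c: "[(m mod 3)^2 + (n mod 3)^2 + (q mod 3)^2 = m^2 + n^2 + q^2] (mod 3)"
      "[(m mod 3) * (n mod 3) * (q mod 3) = m * n * q] (mod 3)"
      by (intro cong_add cong_mult cong_pow; simp)+
    have "[(m mod 3)^2 + (n mod 3)^2 + (q mod 3)^2 = (m mod 3) * (n mod 3) * (q mod 3)] (mod 3)"
      by (rule cong_trans[OF c(1)[unfolded e] cong_sym[OF c(2)]])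
    moreover have "m mod 3 = 0 \<or> m mod 3 = 1 \<or> m mod 3 = 2" "n mod 3 = 0 \<or> n mod 3 = 1 \<or> n mod 3 = 2"
      "q mod 3 = 0 \<or> q mod 3 = 1 \<or> q mod 3 = 2" by presburger+
    ultimately have "m mod 3 = 0 \<and> q mod 3 = 0" by (auto simp: cong_def)
    then have "3 dvd m" "3 dvd q" by (simp_all add: dvd_eq_mod_eq_0)
    then have "3 dvd q" "3 dvd r" using r kh by simp_all
    then show False using cop
      by (metis coprime_common_divisor_int zero_le_numeral num.distinct(3) numeral_eq_one_iff abs_numeral)
  qed
  \<comment> \<open>Modulo 4 the equation forces \<open>m\<close>, \<open>n\<close> and
    \<open>q\<close> to be even, and then \<open>r\<close> is even too.\<close>
  moreover have "(k, h) \<noteq> (1, 2)"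
  proof
    assume kh: "(k, h) = (1, 2)"
    have e: "m^2 + n^2 + 2 * q^2 = 2 * (m * n * q)" using eq kh by simp
    have c: "[(m mod 4)^2 + (n mod 4)^2 + 2 * (q mod 4)^2 = m^2 + n^2 + 2 * q^2] (mod 4)"
      "[2 * ((m mod 4) * (n mod 4) * (q mod 4)) = 2 * (m * n * q)] (mod 4)"
      by (intro cong_add cong_mult cong_pow; simp)+
    have "[(m mod 4)^2 + (n mod 4)^2 + 2 * (q mod 4)^2
        = 2 * ((m mod 4) * (n mod 4) * (q mod 4))] (mod 4)"
      by (rule cong_trans[OF c(1)[unfolded e] cong_sym[OF c(2)]])
    moreover have "m mod 4 = 0 \<or> m mod 4 = 1 \<or> m mod 4 = 2 \<or> m mod 4 = 3"
      "n mod 4 = 0 \<or> n mod 4 = 1 \<or> n mod 4 = 2 \<or> n mod 4 = 3"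
      "q mod 4 = 0 \<or> q mod 4 = 1 \<or> q mod 4 = 2 \<or> q mod 4 = 3" by presburger+
    ultimately have "m mod 4 mod 2 = 0 \<and> q mod 4 mod 2 = 0" by (auto simp: cong_def)
    then have "even m" "even q" by presburger+
    then have "even q" "even r" using r kh by simp_all
    then show False using cop by (metis coprime_common_divisor odd_one)
  qed
  ultimately have "(k, h) \<in> {(3, 1), (2, 2), (1, 5)}" unfolding solvable_pairs_def by auto
  then show thesis using that kmn(2,3) g eq r by blast
qed

section \<open>The three families and the classification\<close>

definition family :: "int \<Rightarrow> int \<Rightarrow> (int \<times> int) set" where
  "family k h = {(k * h * q, k * h * r) | q r. q > 0 \<and> r > 0 \<and>
     (\<exists>m n. m > 0 \<and> n > 0 \<and> m^2 + n^2 + h * q^2 = k * h * m * n * q \<and> q \<le> r \<and> r = k * m * n - q)}"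

lemma T_family: "T3 = family 3 1" "T4 = family 2 2" "T5 = family 1 5"
  unfolding T3_def T4_def T5_def family_def by simp_all

lemma family_gcd:
  assumes "(a, b) \<in> family k h" "(k, h) \<in> {(3, 1), (2, 2), (1, 5)}"
  shows "gcd a b = k * h"
proof -
  obtain q r m n where ab: "a = k * h * q" "b = k * h * r" and "0 < q" "0 < m" "0 < n"
    "m^2 + n^2 + h * q^2 = k * h * m * n * q" "r = k * m * n - q"
    using assms(1) unfolding family_def by blast
  moreover have "0 < k" "0 < h" using assms(2) by auto
  ultimately have "coprime q r" using parametrized_coprime assms(2) by blast
  then have "gcd a b = \<bar>k * h\<bar>" unfolding ab by (simp add: gcd_mult_distrib_int[symmetric] abs_mult)
  then show ?thesis using \<open>0 < k\<close> \<open>0 < h\<close> by simp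
qed

lemma family_square:
  assumes "(a, b) \<in> family k h" "0 < k" "0 < h"
  shows "0 < a \<and> 0 < b \<and> a \<le> b \<and> (\<exists>c. a^2 * b^2 - 4 * (a + b)^2 = c^2)"
proof -
  obtain q r m n where ab: "a = k * h * q" "b = k * h * r" and "0 < q" "0 < r" "q \<le> r"
    and eq: "m^2 + n^2 + h * q^2 = k * h * m * n * q" "r = k * m * n - q"
    using assms(1) unfolding family_def by blast
  then show ?thesis using parametrized_square[OF eq] assms(2,3) unfolding ab by auto
qed

lemma square_family:
  fixes a b c :: int
  assumes "0 < a" "0 < b" "a \<le> b" "a^2 * b^2 - 4 * (a + b)^2 = c^2"
  obtains k h where "(k, h) \<in> {(3, 1), (2, 2), (1, 5)}" "(a, b) \<in> family k h"
proof -
  define g where "g = gcd a b"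
  have g: "0 < g" using assms unfolding g_def by simp
  obtain q r where qr: "a = g * q" "b = g * r" "coprime q r"
    using gcd_coprime_exists[of a b] g unfolding g_def by (metis less_irrefl mult.commute)
  have pos: "0 < q" "0 < r" "q \<le> r" using assms g unfolding qr by (simp_all add: zero_less_mult_iff)
  obtain k h m n where "0 < m" "0 < n" "g = k * h" "(k, h) \<in> {(3, 1), (2, 2), (1, 5)}"
    "m^2 + n^2 + h * q^2 = k * h * m * n * q" "r = k * m * n - q"
    using square_imp_family[of q r g c] pos g qr assms(4) by metis
  then show thesis using that[of k h] pos qr unfolding family_def by blast
qed

theorem theorem2:
  "{(a, b). (0::int) < a \<and> (0::int) < b \<and> a \<le> b \<and>
      (\<exists>c::int. a^2 * b^2 - 4 * (a + b)^2 = c^2)} = T3 \<union> T4 \<union> T5 \<and>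
   T3 \<inter> T4 = {} \<and> T3 \<inter> T5 = {} \<and> T4 \<inter> T5 = {} \<and>
   (\<forall>(a, b) \<in> T3. gcd a b = 3) \<and>
   (\<forall>(a, b) \<in> T4. gcd a b = 4) \<and>
   (\<forall>(a, b) \<in> T5. gcd a b = 5)"
proof -
  have g3: "\<forall>(a, b) \<in> T3. gcd a b = 3" and g4: "\<forall>(a, b) \<in> T4. gcd a b = 4"
    and g5: "\<forall>(a, b) \<in> T5. gcd a b = 5"
    unfolding T_family using family_gcd by fastforce+
  \<comment> \<open>The gcd tells the families apart.\<close>
  have disj: "T3 \<inter> T4 = {}" "T3 \<inter> T5 = {}" "T4 \<inter> T5 = {}" using g3 g4 g5 by fastforce+
  have "{(a, b). (0::int) < a \<and> (0::int) < b \<and> a \<le> b \<and>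
      (\<exists>c::int. a^2 * b^2 - 4 * (a + b)^2 = c^2)} = T3 \<union> T4 \<union> T5" (is "?S = _")
  proof (intro set_eqI iffI; clarify)
    fix a b c :: int
    assume "0 < a" "0 < b" "a \<le> b" "a^2 * b^2 - 4 * (a + b)^2 = c^2" "(a, b) \<notin> T5" "(a, b) \<notin> T4"
    then show "(a, b) \<in> T3" using square_family[of a b c] unfolding T_family by blast
  next
    fix a b :: int
    assume "(a, b) \<in> T3 \<union> T4 \<union> T5"
    then show "0 < a \<and> 0 < b \<and> a \<le> b \<and> (\<exists>c. a^2 * b^2 - 4 * (a + b)^2 = c^2)"
      using family_square unfolding T_family by (metis UnE zero_less_numeral zero_less_one)
  qed
  then show ?thesis using g3 g4 g5 disj by blast
qed

end
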